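(* Let $E=\{e_1,\dots,e_n\}$ be a fixed orthonormal basis of $\mathbb{C}^n$ and let $S$ be a subspace with $\{0\}\subsetneq S\subsetneq\mathbb{C}^n$. Let $P_S$ be the orthogonal projection onto $S$, let $E_i=e_i\otimes e_i$ be the rank one orthogonal projection onto the span of $e_i$ ($i=1,\dots,n$), and let $m_S$ be the moment of $S$ related to $E$. Then $$m_S=W\left(P_SE_1P_S,\,P_SE_2P_S,\dots,P_SE_nP_S\right)\ \cap\ \Big\{x\in\mathbb{R}^n:\sum_{i=1}^n x_i=1\Big\}.$$
   Context: $\mathbb{C}^n$ has its usual inner product $\langle\cdot,\cdot\rangle$ (linear in the first variable) and norm. For $x\in\mathbb{C}^n$ put $x_j=\langle x,e_j\rangle$ and $|x|^2=(|x_1|^2,\dots,|x_n|^2)\in\mathbb{R}^n_{\ge 0}$. The moment of $S$ related to $E$ is $m_S=\operatorname{conv}\{|v|^2: v\in S,\ \|v\|=1\}$, where $\operatorname{conv}$ is the convex hull. For hermitian matrices $A_1,\dots,A_m\in M_n(\mathbb{C})$, the joint numerical range is $$W(A_1,\dots,A_m)=\{(\operatorname{tr}(A_1\rho),\dots,\operatorname{tr}(A_m\rho))\in\mathbb{R}^m:\rho\in\mathcal{D}\},$$ where $\mathcal{D}=\{\rho\in M_n(\mathbb{C}):\rho=\rho^*,\ \rho\ge 0,\ \operatorname{tr}(\rho)=1\}$. For a unit vector $x$, $(x\otimes x)(v)=\langle v,x\rangle x$. *)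

theory Defs
  imports "HOL-Analysis.Analysis"
begin

text \<open>The complex inner product on complex vectors, linear in the first variable. (The library's
  inner product on this type is its real part, see \<open>inner_eq_Re_cinner\<close> below; the library norm is
  the norm induced by either.)\<close>

definition cinner :: "complex^'n \<Rightarrow> complex^'n \<Rightarrow> complex" where
  "cinner x y = (\<Sum>i\<in>UNIV. x $ i * cnj (y $ i))"

text \<open>The basis vectors are indexed by the same finite type as the coordinates, so that there are
  exactly as many of them as the dimension. Subspaces and spans over the complex scalars are those
  of the interpretation \<open>vec\<close>; the unqualified \<open>subspace\<close> and \<open>span\<close> refer to real scalars.\<close>

definition orthonormal_basis :: "('n \<Rightarrow> complex^'n) \<Rightarrow> bool" where
  "orthonormal_basis e \<longleftrightarrow>
     (\<forall>i j. cinner (e i) (e j) = (if i = j then 1 else 0)) \<and> vec.span (range e) = UNIV"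

definition moment :: "('n \<Rightarrow> complex^'n) \<Rightarrow> (complex^'n) set \<Rightarrow> (real^'n) set" where
  "moment e S = convex hull ((\<lambda>v. \<chi> i. (cmod (cinner v (e i)))\<^sup>2) ` {v \<in> S. norm v = 1})"

definition rank_one :: "complex^'n \<Rightarrow> complex^'n^'n" where
  "rank_one x = matrix (\<lambda>v. cinner v x *s x)"

text \<open>For a complex subspace the described vector exists and is unique, see
  \<open>orth_proj_works\<close> and \<open>orth_proj_eqI\<close> below.\<close>

definition orth_proj :: "(complex^'n) set \<Rightarrow> complex^'n^'n" where
  "orth_proj S = matrix (\<lambda>v. THE p. p \<in> S \<and> (\<forall>w\<in>S. cinner (v - p) w = 0))"

definition conj_transpose :: "complex^'n^'n \<Rightarrow> complex^'n^'n" where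
  "conj_transpose A = (\<chi> i j. cnj (A $ j $ i))"

definition hermitian :: "complex^'n^'n \<Rightarrow> bool" where
  "hermitian A \<longleftrightarrow> conj_transpose A = A"

definition density_matrices :: "(complex^'n^'n) set" where
  "density_matrices =
     {\<rho>. hermitian \<rho> \<and> (\<forall>v. cinner (\<rho> *v v) v \<in> \<real>\<^sub>\<ge>\<^sub>0) \<and> trace \<rho> = 1}"

text \<open>The joint numerical range of a tuple of hermitian matrices indexed by a finite type. The
  traces are real for hermitian matrices, so membership says that they are the entries of \<open>x\<close>.\<close>

definition joint_numerical_range :: "('m \<Rightarrow> complex^'n^'n) \<Rightarrow> (real^'m) set" where
  "joint_numerical_range A =
     {x. \<exists>\<rho>\<in>density_matrices. \<forall>j. complex_of_real (x $ j) = trace (A j ** \<rho>)}"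


lemma inner_eq_Re_cinner: "x \<bullet> y = Re (cinner x y)"
  by (simp add: inner_vec_def cinner_def inner_complex_def)

lemma cinner_self: "cinner x x = complex_of_real ((norm x)\<^sup>2)"
proof -
  have "Im (cinner x x) = 0" by (simp add: cinner_def algebra_simps)
  then show ?thesis
    by (simp add: complex_eq_iff power2_norm_eq_inner inner_eq_Re_cinner)
qed

lemma cinner_add_left: "cinner (x + y) z = cinner x z + cinner y z"
  and cinner_diff_left: "cinner (x - y) z = cinner x z - cinner y z"
  and cinner_scale_left: "cinner (c *s x) z = c * cinner x z"
  and cinner_scale_right: "cinner x (c *s z) = cnj c * cinner x z"
  and cinner_diff_right: "cinner x (y - z) = cinner x y - cinner x z"
  and cinner_commute: "cinner x y = cnj (cinner y x)"
  by (simp_all add: cinner_def sum.distrib sum_subtractf sum_distrib_left algebra_simps)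

lemma matrix_vector_mult_rank_one: "rank_one x *v v = cinner v x *s x"
proof -
  have "Vector_Spaces.linear (*s) (*s) (\<lambda>v. cinner v x *s x)"
    by unfold_locales (auto simp: vec_eq_iff cinner_add_left cinner_scale_left algebra_simps)
  then show ?thesis by (simp add: rank_one_def matrix_works)
qed

lemma orth_proj_ex1:
  assumes S: "vec.subspace S"
  shows "\<exists>!p. p \<in> S \<and> (\<forall>w\<in>S. cinner (v - p) w = 0)"
proof -
  have scaleR: "r *\<^sub>R x = complex_of_real r *s x" for r and x :: "complex^'n"
    by (simp add: vec_eq_iff) (simp add: scaleR_conv_of_real)
  have "subspace S"
    unfolding subspace_def using S
    by (auto simp: scaleR vec.subspace_0 vec.subspace_add vec.subspace_scale)
  then have span: "span S = S" by (simp add: span_eq_iff)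
  obtain y z where y: "y \<in> S" and z: "\<And>w. w \<in> S \<Longrightarrow> z \<bullet> w = 0" and v: "v = y + z"
    using orthogonal_subspace_decomp_exists[of S v] unfolding span orthogonal_def by metis
  have "cinner z w = 0" if "w \<in> S" for w
  proof -
    have "\<i> *s w \<in> S" using S that by (simp add: vec.subspace_scale)
    then have "Re (cinner z (\<i> *s w)) = 0" using z by (simp add: inner_eq_Re_cinner)
    moreover have "Re (cinner z w) = 0" using z[OF that] by (simp add: inner_eq_Re_cinner)
    ultimately show ?thesis by (simp add: cinner_scale_right complex_eq_iff)
  qed
  then have ex: "y \<in> S \<and> (\<forall>w\<in>S. cinner (v - y) w = 0)" using y v by simp
  moreover have "p = y" if p: "p \<in> S \<and> (\<forall>w\<in>S. cinner (v - p) w = 0)" for p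
  proof -
    have "p - y \<in> S" using p ex S by (simp add: vec.subspace_diff)
    then have "cinner (v - y) (p - y) - cinner (v - p) (p - y) = 0" using p ex by simp
    then have "cinner (p - y) (p - y) = 0" by (simp add: cinner_diff_left)
    then show ?thesis by (simp add: cinner_self)
  qed
  ultimately show ?thesis by blast
qed

lemma orth_proj_works:
  assumes S: "vec.subspace S"
  shows "orth_proj S *v v \<in> S" "w \<in> S \<Longrightarrow> cinner (v - orth_proj S *v v) w = 0"
proof -
  let ?Q = "\<lambda>v p. p \<in> S \<and> (\<forall>w\<in>S. cinner (v - p) w = 0)"
  define f where "f v = (THE p. ?Q v p)" for v
  have f: "?Q v (f v)" for v
    unfolding f_def by (rule theI'[OF orth_proj_ex1[OF S]])
  have eq: "f v = p" if "?Q v p" for v p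
    using that f orth_proj_ex1[OF S] by blast
  have "f (x + y) = f x + f y" for x y
    by (rule eq) (use f[of x] f[of y] S in
      \<open>auto simp: vec.subspace_add cinner_add_left cinner_diff_left algebra_simps\<close>)
  moreover have "f (c *s x) = c *s f x" for c x
    by (rule eq) (use f[of x] S in
      \<open>auto simp: vec.subspace_scale cinner_scale_left cinner_diff_left\<close>)
  ultimately have "Vector_Spaces.linear (*s) (*s) f"
    by unfold_locales (auto simp: algebra_simps vec_eq_iff)
  then have *: "orth_proj S *v v = f v"
    by (simp add: orth_proj_def f_def[abs_def, symmetric] matrix_works)
  show "orth_proj S *v v \<in> S" using f[of v] by (simp add: *)
  show "w \<in> S \<Longrightarrow> cinner (v - orth_proj S *v v) w = 0" using f[of v] by (simp add: *)
qed

lemma orth_proj_eqI: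
  assumes "vec.subspace S" "p \<in> S" "\<And>w. w \<in> S \<Longrightarrow> cinner (v - p) w = 0"
  shows "orth_proj S *v v = p"
  using assms orth_proj_works[OF assms(1)] orth_proj_ex1[OF assms(1), of v] by blast

lemma hermitianI:
  assumes "\<And>v w. cinner (A *v v) w = cinner v (A *v w)"
  shows "hermitian A"
proof -
  have l: "cinner (B *v axis i 1) (axis j 1) = B $ j $ i"
    and r: "cinner (axis i 1) (B *v axis j 1) = cnj (B $ i $ j)" for B :: "complex^'n^'n" and i j
    by (simp_all add: cinner_def matrix_vector_mult_def axis_def if_distrib
        if_distribR cong: if_cong)
  have "cnj (A $ i $ j) = A $ j $ i" for i j
    using assms[of "axis i 1" "axis j 1"] unfolding l r by (rule sym)
  then show ?thesis unfolding hermitian_def conj_transpose_def vec_eq_iff by simp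
qed

lemma cinner_orth_proj:
  assumes S: "vec.subspace S"
  shows "cinner (orth_proj S *v v) w = cinner v (orth_proj S *v w)"
proof -
  let ?P = "\<lambda>v. orth_proj S *v v"
  have right: "cinner v (?P w) = cinner (?P v) (?P w)"
    using orth_proj_works(2)[OF S orth_proj_works(1)[OF S], of v w] by (simp add: cinner_diff_left)
  have "cinner w (?P v) = cinner (?P w) (?P v)"
    using orth_proj_works(2)[OF S orth_proj_works(1)[OF S], of w v] by (simp add: cinner_diff_left)
  then have left: "cinner (?P v) w = cinner (?P v) (?P w)"
    unfolding cinner_commute[of "?P v" w] cinner_commute[of "?P v" "?P w"] by (rule arg_cong)
  show ?thesis by (rule trans[OF left right[symmetric]])
qed

lemma hermitian_compression:
  assumes "vec.subspace S"
  shows "hermitian (orth_proj S ** rank_one x ** orth_proj S)"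
proof (rule hermitianI)
  fix v w
  have "cinner (rank_one x *v v) w = cinner v (rank_one x *v w)" for v w
    unfolding matrix_vector_mult_rank_one cinner_scale_left cinner_scale_right
    by (subst cinner_commute[of x w]) (rule mult.commute)
  then show "cinner ((orth_proj S ** rank_one x ** orth_proj S) *v v) w
    = cinner v ((orth_proj S ** rank_one x ** orth_proj S) *v w)"
    by (simp add: matrix_vector_mul_assoc[symmetric] cinner_orth_proj[OF assms])
qed

end

(* A positive matrix \<rho> is a sum of rank one matrices rank_one w_k: no spectral theorem is
   needed, because orthogonality of the w_k plays no role, and Cholesky elimination produces them.
   The numbers tr(P E_i P \<rho>) are then the sums over k of |<P w_k, e_i>|^2, and by Parseval
   their sum over i is the sum of the |P w_k|^2. If this is 1, normalising the nonzero P w_k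
   exhibits the point as a convex combination of points of the moment. *)

theory Submission
  imports Defs
begin

section \<open>The inner product, rank one matrices and their traces, and Parseval's
  identity\<close>

lemma cinner_add_right: "cinner x (y + z) = cinner x y + cinner x z"
  by (simp add: cinner_def sum.distrib algebra_simps)

lemma cinner_sum_left: "cinner (sum f A) z = (\<Sum>i\<in>A. cinner (f i) z)"
  by (simp add: cinner_def sum_distrib_right) (rule sum.swap)

lemma cinner_mult_commute: "cinner x y * cinner y x = complex_of_real ((cmod (cinner x y))\<^sup>2)"
  using complex_norm_square[of "cinner x y"] cinner_commute[of y x] by simp

lemma matrix_vector_mult_axis: "(A :: complex^'n^'m) *v axis j 1 = column j A"
  by (simp add: vec_eq_iff matrix_vector_mult_def column_def axis_def if_distrib cong: if_cong)

lemma rank_one_nth: "rank_one x $ i $ j = x $ i * cnj (x $ j)"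
proof -
  have "rank_one x $ i $ j = (rank_one x *v axis j 1) $ i"
    by (simp add: matrix_vector_mult_axis column_def)
  also have "\<dots> = x $ i * cnj (x $ j)"
    by (simp add: matrix_vector_mult_rank_one cinner_def axis_def if_distrib if_distribR cong: if_cong)
  finally show ?thesis .
qed

text \<open>This turns traces against projections into values of a quadratic form, the shape in
  which all later traces are computed.\<close>

lemma trace_rank_one_mult: "trace (rank_one x ** A) = cinner (A *v x) x"
proof -
  have "trace (rank_one x ** A) = (\<Sum>i\<in>UNIV. \<Sum>j\<in>UNIV. x $ i * cnj (x $ j) * A $ j $ i)"
    by (simp add: trace_def matrix_matrix_mult_def rank_one_nth)
  also have "\<dots> = (\<Sum>j\<in>UNIV. \<Sum>i\<in>UNIV. x $ i * cnj (x $ j) * A $ j $ i)"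
    by (rule sum.swap)
  also have "\<dots> = cinner (A *v x) x"
    by (simp add: cinner_def matrix_vector_mult_def sum_distrib_left sum_distrib_right algebra_simps)
  finally show ?thesis .
qed

lemma trace_rank_one: "trace (rank_one x) = cinner x x"
  using trace_rank_one_mult[of x "mat 1"] by simp

lemma cinner_rank_one: "cinner (rank_one x *v v) w = cinner v x * cinner x w"
  by (simp add: matrix_vector_mult_rank_one cinner_scale_left)

lemma cinner_rank_one_swap: "cinner (rank_one x *v v) w = cinner v (rank_one x *v w)"
  unfolding matrix_vector_mult_rank_one cinner_scale_left cinner_scale_right
  by (subst cinner_commute[of x w]) (rule mult.commute)

lemma hermitian_cinner:
  assumes "hermitian A"
  shows "cinner (A *v v) w = cinner v (A *v w)"
proof -
  have "cnj (A $ j $ i) = A $ i $ j" for i j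
    using assms by (simp add: hermitian_def conj_transpose_def vec_eq_iff)
  then have "cinner v (A *v w) = (\<Sum>i\<in>UNIV. \<Sum>j\<in>UNIV. v $ i * (A $ j $ i * cnj (w $ j)))"
    by (simp add: cinner_def matrix_vector_mult_def sum_distrib_left)
  also have "\<dots> = (\<Sum>j\<in>UNIV. \<Sum>i\<in>UNIV. v $ i * (A $ j $ i * cnj (w $ j)))"
    by (rule sum.swap)
  also have "\<dots> = cinner (A *v v) w"
    by (simp add: cinner_def matrix_vector_mult_def sum_distrib_left sum_distrib_right algebra_simps)
  finally show ?thesis by simp
qed

text \<open>Subtracting from \<open>v\<close> its expansion in the basis leaves a vector
  \<open>z\<close> orthogonal to every \<open>e j\<close>. The vectors orthogonal to
  \<open>z\<close> form a complex subspace, which then contains the span of the basis and so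
  \<open>z\<close> itself; this forces \<open>z = 0\<close>.\<close>

lemma parseval:
  assumes "orthonormal_basis e"
  shows "(\<Sum>i\<in>UNIV. (cmod (cinner v (e i)))\<^sup>2) = (norm v)\<^sup>2"
proof -
  have sp: "vec.span (range e) = UNIV"
    and orth: "cinner (e i) (e j) = (if i = j then 1 else 0)" for i j
    using assms by (auto simp: orthonormal_basis_def)
  define z where "z = v - (\<Sum>i\<in>UNIV. cinner v (e i) *s e i)"
  have z: "cinner z (e j) = 0" for j
    by (simp add: z_def cinner_diff_left cinner_sum_left cinner_scale_left orth if_distrib cong: if_cong)
  have "vec.subspace {u. cinner z u = 0}"
    by (auto simp: vec.subspace_def cinner_add_right cinner_scale_right) (simp add: cinner_def)
  then have "vec.span (range e) \<subseteq> {u. cinner z u = 0}"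
    by (intro vec.span_minimal) (auto simp: z)
  then have "cinner z z = 0" unfolding sp by auto
  then have v: "v = (\<Sum>i\<in>UNIV. cinner v (e i) *s e i)"
    by (simp add: cinner_self z_def)
  have "complex_of_real ((norm v)\<^sup>2) = cinner (\<Sum>i\<in>UNIV. cinner v (e i) *s e i) v"
    using v cinner_self[of v] by simp
  also have "\<dots> = complex_of_real (\<Sum>i\<in>UNIV. (cmod (cinner v (e i)))\<^sup>2)"
    by (simp add: cinner_sum_left cinner_scale_left cinner_mult_commute del: of_real_power)
  finally show ?thesis by (simp only: of_real_eq_iff)
qed

section \<open>Positive matrices and their decomposition into rank one matrices\<close>

definition positive :: "complex^'n^'n \<Rightarrow> bool" where
  "positive A \<longleftrightarrow>
     (\<forall>v w. cinner (A *v v) w = cinner v (A *v w)) \<and> (\<forall>v. 0 \<le> Re (cinner (A *v v) v))"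

text \<open>Symmetry makes the value equal to its own conjugate, so the \<open>Re\<close> in
  \<open>positive\<close> loses no information.\<close>

lemma positive_cinner_self:
  assumes "positive A"
  shows "cinner (A *v v) v = complex_of_real (Re (cinner (A *v v) v))"
proof -
  have "cnj (cinner (A *v v) v) = cinner (A *v v) v"
    using assms cinner_commute[of v "A *v v"] by (simp add: positive_def)
  then show ?thesis by (simp add: complex_eq_iff)
qed

text \<open>With \<open>v = A *v u\<close>, the form of \<open>A\<close> at \<open>v + t u\<close>
  is affine in real \<open>t\<close>: the quadratic coefficient is
  \<open>cinner (A *v u) u = 0\<close>, and the slope is twice the squared norm of \<open>v\<close>.
  A nonzero slope would make the form negative somewhere.\<close>

lemma positive_null_vector:
  assumes A: "positive A" and u: "cinner (A *v u) u = 0"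
  shows "A *v u = 0"
proof (rule ccontr)
  assume "A *v u \<noteq> 0"
  define v where "v = A *v u"
  define b where "b = (norm v)\<^sup>2"
  have b: "b > 0" using \<open>A *v u \<noteq> 0\<close> by (simp add: b_def v_def)
  \<comment> \<open>The point at which this affine function takes the value -1.\<close>
  define t where "t = - (Re (cinner (A *v v) v) + 1) / (2 * b)"
  have sym: "cinner (A *v x) y = cinner x (A *v y)" for x y
    using A by (simp add: positive_def)
  have Au: "A *v u = v" "cinner v u = 0" "cinner (A *v v) u = cinner v v"
    using u by (simp_all add: sym v_def)
  have "cinner (A *v (v + complex_of_real t *s u)) (v + complex_of_real t *s u)
      = cinner (A *v v) v + complex_of_real t * cinner v v + complex_of_real t * cinner v v"
    by (simp add: matrix_vector_right_distrib vector_scalar_commute cinner_add_left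
        cinner_add_right cinner_scale_left cinner_scale_right Au)
  then have "Re (cinner (A *v (v + complex_of_real t *s u)) (v + complex_of_real t *s u))
      = Re (cinner (A *v v) v) + 2 * t * b"
    by (simp add: cinner_self b_def del: of_real_power)
  also have "\<dots> = -1" using b by (simp add: t_def field_simps)
  finally show False using A unfolding positive_def
    by (metis neg_0_le_iff_le not_one_le_zero)
qed

text \<open>Completing the square: the form of \<open>A - rank_one w\<close> at \<open>v\<close> is
  the form of \<open>A\<close> at \<open>v - c u\<close> for a suitable \<open>c\<close>, hence
  nonnegative. The factor \<open>1 / sqrt a\<close> makes \<open>rank_one w\<close> agree with
  \<open>A\<close> at \<open>u\<close>.\<close>

lemma positive_eliminate:
  assumes A: "positive A" and a: "cinner (A *v u) u = complex_of_real a" "a > 0"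
  defines "w \<equiv> complex_of_real (1 / sqrt a) *s (A *v u)"
  shows "positive (A - rank_one w)"
proof -
  have sym: "cinner (A *v x) y = cinner x (A *v y)" for x y
    using A by (simp add: positive_def)
  have "0 \<le> Re (cinner ((A - rank_one w) *v v) v)" for v
  proof -
    \<comment> \<open>This \<open>c\<close> makes \<open>A *v (v - c *s u)\<close> orthogonal to
      \<open>u\<close>.\<close>
    define c where "c = cinner v (A *v u) / complex_of_real a"
    have sq: "complex_of_real (sqrt a) * complex_of_real (sqrt a) = complex_of_real a"
      using a(2) by (simp flip: of_real_mult)
    have ca: "c * complex_of_real a = cinner v (A *v u)" using a(2) by (simp add: c_def)
    have "cinner (A *v (v - c *s u)) (v - c *s u)
        = cinner (A *v v) v - cnj c * cinner v (A *v u) - c * cinner u (A *v v)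
          + c * cnj c * complex_of_real a"
      using a(1) by (simp add: matrix_vector_mult_diff_distrib vector_scalar_commute
          cinner_diff_left cinner_diff_right cinner_scale_left cinner_scale_right sym algebra_simps)
    also have "\<dots> = cinner (A *v v) v - c * cinner u (A *v v)"
      by (simp add: algebra_simps flip: ca)
    also have "c * cinner u (A *v v) = cinner (rank_one w *v v) v"
      using a(2) by (simp add: cinner_rank_one w_def cinner_scale_left cinner_scale_right c_def sq sym
          divide_simps)
    finally have "cinner ((A - rank_one w) *v v) v = cinner (A *v (v - c *s u)) (v - c *s u)"
      by (simp add: matrix_vector_mult_diff_rdistrib cinner_diff_left)
    then show ?thesis using A unfolding positive_def by metis
  qed
  then show ?thesis
    by (simp add: positive_def matrix_vector_mult_diff_rdistrib cinner_diff_left cinner_diff_right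
        sym cinner_rank_one_swap)
qed

text \<open>Cholesky elimination: \<open>K\<close> contains the indices of the nonzero columns.\<close>

lemma positive_sum_rank_one_aux:
  assumes "finite K" "positive A" "\<And>i. i \<notin> K \<Longrightarrow> A *v axis i 1 = 0"
  shows "\<exists>w. A = (\<Sum>k\<in>K. rank_one (w k))"
  using assms
proof (induction K arbitrary: A rule: finite_induct)
  case empty
  have "column i A = 0" for i
    using empty(2)[of i] by (simp add: matrix_vector_mult_axis)
  then have "A = 0" by (simp add: vec_eq_iff column_def)
  then show ?case by simp
next
  case (insert k K)
  let ?u = "axis k 1 :: complex^'a"
  \<comment> \<open>The pivot, that is, the diagonal entry of \<open>A\<close> at
    \<open>k\<close>.\<close>
  define a where "a = Re (cinner (A *v ?u) ?u)"
  have a: "cinner (A *v ?u) ?u = complex_of_real a" "a \<ge> 0"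
    using positive_cinner_self[OF insert.prems(1)] insert.prems(1) by (auto simp: a_def positive_def)
  \<comment> \<open>For \<open>a = 0\<close> division by zero gives \<open>w = 0\<close>, so one
    formula also covers the case in which nothing is eliminated.\<close>
  define w where "w = complex_of_real (1 / sqrt a) *s (A *v ?u)"
  have sym: "cinner (A *v x) y = cinner x (A *v y)" for x y
    using insert.prems(1) by (simp add: positive_def)
  have pos: "positive (A - rank_one w)"
  proof (cases "a = 0")
    case True
    have "w = 0" by (simp add: w_def True)
    then have "rank_one w = 0" by (simp add: vec_eq_iff rank_one_nth)
    then show ?thesis using insert.prems by simp
  next
    case False
    then show ?thesis using positive_eliminate[OF insert.prems(1) a(1)] a(2) by (simp add: w_def)
  qed
  have "(A - rank_one w) *v axis i 1 = 0" if "i \<notin> K" for i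
  proof (cases "i = k")
    case True
    show ?thesis
    proof (cases "a = 0")
      case True
      \<comment> \<open>A positive matrix with a zero pivot already has a zero column there.\<close>
      then have "A *v ?u = 0" using positive_null_vector[OF insert.prems(1)] a by simp
      then show ?thesis using \<open>i = k\<close>
        by (simp add: matrix_vector_mult_diff_rdistrib matrix_vector_mult_rank_one w_def)
    next
      case False
      then have "complex_of_real (sqrt a) * complex_of_real (sqrt a) = complex_of_real a"
        using a(2) by (simp flip: of_real_mult)
      then have "rank_one w *v ?u = A *v ?u"
        using a(1) False by (simp add: matrix_vector_mult_rank_one w_def cinner_scale_right
            flip: sym)
      then show ?thesis using \<open>i = k\<close> by (simp add: matrix_vector_mult_diff_rdistrib)
    qed
  next
    case False
    then have "A *v axis i 1 = 0" using insert.prems(2) that by simp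
    \<comment> \<open>\<open>rank_one w\<close> sends \<open>axis i 1\<close> to a multiple of this
      inner product times \<open>w\<close>. Symmetry moves \<open>A\<close> onto the zero column, so
      elimination keeps that column zero.\<close>
    moreover from this have "cinner (axis i 1) (A *v ?u) = 0"
      unfolding sym[symmetric] by (simp add: cinner_def)
    ultimately show ?thesis
      by (simp add: matrix_vector_mult_diff_rdistrib matrix_vector_mult_rank_one w_def
          cinner_scale_right)
  qed
  then obtain f where f: "A - rank_one w = (\<Sum>j\<in>K. rank_one (f j))"
    using insert.IH[OF pos] by blast
  have "(\<Sum>j\<in>K. rank_one ((f(k := w)) j)) = (\<Sum>j\<in>K. rank_one (f j))"
    using insert.hyps by (intro sum.cong) auto
  then have "A = (\<Sum>j\<in>insert k K. rank_one ((f(k := w)) j))"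
    using insert.hyps by (simp add: algebra_simps flip: f)
  then show ?case by blast
qed

lemma positive_sum_rank_one:
  fixes A :: "complex^'n^'n"
  assumes "positive A"
  obtains w :: "'n \<Rightarrow> complex^'n" where "A = (\<Sum>k\<in>UNIV. rank_one (w k))"
  \<comment> \<open>With all indices in \<open>K\<close>, the condition on zero columns is
    vacuous.\<close>
  using positive_sum_rank_one_aux[of UNIV A] assms by auto

section \<open>Density matrices, convexity of the joint numerical range, and traces of
  compressions\<close>

lemma density_matrix_positive:
  assumes "\<rho> \<in> density_matrices"
  shows "positive \<rho>"
  using assms by (auto simp: positive_def density_matrices_def hermitian_cinner
      complex_nonneg_Reals_iff)

lemma rank_one_density_matrix:
  assumes "norm v = 1"
  shows "rank_one v \<in> density_matrices"
proof -
  have "cinner (rank_one v *v x) x \<in> \<real>\<^sub>\<ge>\<^sub>0" for x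
    by (simp add: cinner_rank_one cinner_mult_commute del: of_real_power)
  then show ?thesis using assms
    by (simp add: density_matrices_def trace_rank_one cinner_self hermitianI cinner_rank_one_swap)
qed

lemma scaleR_eq_vector_scalar_mult: "r *\<^sub>R (x::complex^'n) = complex_of_real r *s x"
  by (simp add: vec_eq_iff) (simp add: scaleR_conv_of_real)

lemma scaleR_matrix_vector_mult:
  "(r *\<^sub>R (A::complex^'n^'m)) *v x = complex_of_real r *s (A *v x)"
  by (simp add: vec_eq_iff matrix_vector_mult_def sum_distrib_left)
    (simp add: scaleR_conv_of_real algebra_simps)

lemma trace_scaleR: "trace (r *\<^sub>R (A::complex^'n^'n)) = complex_of_real r * trace A"
  by (simp add: trace_def sum_distrib_left) (simp add: scaleR_conv_of_real)

lemma matrix_mult_scaleR: "(A::complex^'n^'n) ** (r *\<^sub>R B) = r *\<^sub>R (A ** B)"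
  by (simp add: vec_eq_iff matrix_matrix_mult_def scaleR_sum_right)

lemma convex_density_matrices: "convex density_matrices"
proof (rule convexI)
  fix A B :: "complex^'n^'n" and s t :: real
  assume A: "A \<in> density_matrices" and B: "B \<in> density_matrices"
    and st: "0 \<le> s" "0 \<le> t" "s + t = 1"
  have "cinner ((s *\<^sub>R A + t *\<^sub>R B) *v v) v \<in> \<real>\<^sub>\<ge>\<^sub>0" for v
    using A B st by (auto simp: density_matrices_def matrix_vector_mult_add_rdistrib cinner_add_left
        scaleR_matrix_vector_mult cinner_scale_left)
  moreover have "hermitian (s *\<^sub>R A + t *\<^sub>R B)"
    using A B by (simp add: density_matrices_def hermitian_def conj_transpose_def vec_eq_iff)
  moreover have "trace (s *\<^sub>R A + t *\<^sub>R B) = 1"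
    using A B st by (simp add: density_matrices_def trace_add trace_scaleR flip: of_real_add)
  ultimately show "s *\<^sub>R A + t *\<^sub>R B \<in> density_matrices"
    by (simp add: density_matrices_def)
qed

text \<open>The traces are linear in the density matrix, so convexity is inherited from
  \<open>density_matrices\<close>. It reduces one inclusion of the theorem to the generators of the
  convex hull.\<close>

lemma convex_joint_numerical_range: "convex (joint_numerical_range A)"
proof (rule convexI)
  fix x y and s t :: real
  assume x: "x \<in> joint_numerical_range A" and y: "y \<in> joint_numerical_range A"
    and st: "0 \<le> s" "0 \<le> t" "s + t = 1"
  from x y obtain \<rho> \<sigma> where "\<rho> \<in> density_matrices" "\<sigma> \<in> density_matrices"
    and "\<And>j. complex_of_real (x $ j) = trace (A j ** \<rho>)"
    and "\<And>j. complex_of_real (y $ j) = trace (A j ** \<sigma>)"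
    by (auto simp: joint_numerical_range_def)
  then show "s *\<^sub>R x + t *\<^sub>R y \<in> joint_numerical_range A"
    unfolding joint_numerical_range_def using convexD[OF convex_density_matrices _ _ st]
    by (auto intro!: bexI[of _ "s *\<^sub>R \<rho> + t *\<^sub>R \<sigma>"]
        simp: matrix_add_ldistrib trace_add matrix_mult_scaleR trace_scaleR)
qed

text \<open>Cyclicity carries the left projection behind \<open>A\<close>, and self-adjointness of
  the projection then moves it to the other argument of the form.\<close>

lemma trace_compression:
  assumes "vec.subspace S"
  shows "trace ((orth_proj S ** rank_one x ** orth_proj S) ** A)
    = cinner (A *v (orth_proj S *v x)) (orth_proj S *v x)"
proof -
  have "trace ((orth_proj S ** rank_one x ** orth_proj S) ** A)
      = trace (rank_one x ** (orth_proj S ** A ** orth_proj S))"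
    using trace_mul_sym[of "orth_proj S" "rank_one x ** orth_proj S ** A"]
    by (simp add: matrix_mul_assoc)
  then show ?thesis
    by (simp add: trace_rank_one_mult cinner_orth_proj[OF assms] flip: matrix_vector_mul_assoc)
qed

text \<open>Normalising \<open>u\<close> divides its squared coordinates by its squared norm. These
  squared norms become the weights of the convex combination in the theorem.\<close>

lemma scaled_in_moment:
  assumes S: "vec.subspace S" and u: "u \<in> S" "u \<noteq> 0"
  shows "\<exists>y \<in> moment e S. (\<chi> i. (cmod (cinner u (e i)))\<^sup>2) = (norm u)\<^sup>2 *\<^sub>R y"
proof
  let ?v = "complex_of_real (1 / norm u) *s u"
  have "?v \<in> S" using S u by (intro vec.subspace_scale)
  moreover have "norm ?v = 1" using u(2) unfolding scaleR_eq_vector_scalar_mult[symmetric] by simp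
  ultimately show "(\<chi> i. (cmod (cinner ?v (e i)))\<^sup>2) \<in> moment e S"
    unfolding moment_def by (intro hull_inc) auto
  show "(\<chi> i. (cmod (cinner u (e i)))\<^sup>2) = (norm u)\<^sup>2 *\<^sub>R (\<chi> i. (cmod (cinner ?v (e i)))\<^sup>2)"
    using u(2) by (simp add: vec_eq_iff cinner_scale_left norm_mult norm_divide power_mult_distrib
        power_divide)
qed

section \<open>The two inclusions between the moment and the slice of the joint numerical
  range\<close>

theorem theorem6p3:
  fixes e :: "'n::finite \<Rightarrow> complex^'n" and S :: "(complex^'n) set"
  assumes "orthonormal_basis e"
    and "vec.subspace S" and "{0} \<subset> S" and "S \<subset> UNIV"
  shows "moment e S =
    joint_numerical_range (\<lambda>i. orth_proj S ** rank_one (e i) ** orth_proj S)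
      \<inter> {x :: real^'n. (\<Sum>i\<in>UNIV. x $ i) = 1}"
    (is "_ = ?W \<inter> ?H")
proof
  let ?P = "orth_proj S"
  have P: "cinner x (?P *v y) = cinner (?P *v x) y" for x y
    by (simp add: cinner_orth_proj[OF assms(2)])
  show "moment e S \<subseteq> ?W \<inter> ?H"
    unfolding moment_def
  proof (rule hull_minimal)
    have "convex ?H"
      by (rule convexI) (simp add: sum.distrib flip: sum_distrib_left)
    then show "convex (?W \<inter> ?H)"
      by (intro convex_Int convex_joint_numerical_range)
    show "(\<lambda>v. \<chi> i. (cmod (cinner v (e i)))\<^sup>2) ` {v \<in> S. norm v = 1} \<subseteq> ?W \<inter> ?H"
    proof clarify
      fix v assume v: "v \<in> S" "norm v = 1"
      have Pv: "?P *v v = v"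
        by (rule orth_proj_eqI) (use assms(2) v in \<open>auto simp: cinner_def\<close>)
      \<comment> \<open>The density matrix for a generator is \<open>rank_one v\<close>; as the
        projection fixes \<open>v\<close>, compressing does not change the trace.\<close>
      have "complex_of_real ((cmod (cinner v (e i)))\<^sup>2)
          = trace ((?P ** rank_one (e i) ** ?P) ** rank_one v)" for i
        unfolding trace_compression[OF assms(2)] cinner_rank_one
        unfolding cinner_orth_proj[OF assms(2)] Pv
        unfolding P Pv by (subst mult.commute) (simp only: cinner_mult_commute)
      then have "(\<chi> i. (cmod (cinner v (e i)))\<^sup>2) \<in> ?W"
        unfolding joint_numerical_range_def
        by (auto intro!: bexI[OF _ rank_one_density_matrix[OF v(2)]] simp del: of_real_power)
      then show "(\<chi> i. (cmod (cinner v (e i)))\<^sup>2) \<in> ?W \<inter> ?H"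
        using parseval[OF assms(1), of v] v by simp
    qed
  qed
  show "?W \<inter> ?H \<subseteq> moment e S"
  proof clarify
    fix x assume "x \<in> ?W" and sum_x: "(\<Sum>i\<in>UNIV. x $ i) = 1"
    then obtain \<rho> where \<rho>: "\<rho> \<in> density_matrices"
      and x: "\<And>i. complex_of_real (x $ i) = trace ((?P ** rank_one (e i) ** ?P) ** \<rho>)"
      by (auto simp: joint_numerical_range_def)
    from positive_sum_rank_one[OF density_matrix_positive[OF \<rho>]]
    obtain w :: "'n \<Rightarrow> complex^'n" where w: "\<rho> = (\<Sum>k\<in>UNIV. rank_one (w k))" .
    define u where "u k = ?P *v w k" for k
    have uS: "u k \<in> S" for k by (simp add: u_def orth_proj_works(1)[OF assms(2)])
    \<comment> \<open>Read as a trace, the form allows \<open>\<rho>\<close> to be moved to the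
      front and split into its summands, each of which contributes one squared modulus.\<close>
    have rho: "cinner (\<rho> *v y) y = complex_of_real (\<Sum>k\<in>UNIV. (cmod (cinner (w k) y))\<^sup>2)" for y
    proof -
      have "cinner (\<rho> *v y) y = trace (rank_one y ** \<rho>)" by (simp add: trace_rank_one_mult)
      also have "\<dots> = trace (\<rho> ** rank_one y)" by (rule trace_mul_sym)
      also have "\<dots> = (\<Sum>k\<in>UNIV. trace (rank_one (w k) ** rank_one y))"
      proof -
        have "\<rho> ** rank_one y = (\<Sum>k\<in>UNIV. rank_one (w k) ** rank_one y)"
          unfolding w
          by (simp add: vec_eq_iff matrix_matrix_mult_def sum_distrib_right) (intro allI sum.swap)
        moreover have "trace (\<Sum>k\<in>(UNIV::'n set). f k) = (\<Sum>k\<in>UNIV. trace (f k))"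
          for f :: "'n \<Rightarrow> complex^'n^'n"
          by (simp add: trace_def) (rule sum.swap)
        ultimately show ?thesis by simp
      qed
      finally show ?thesis
        by (simp add: trace_rank_one_mult cinner_rank_one cinner_mult_commute del: of_real_power)
    qed
    \<comment> \<open>Self-adjointness shifts the projection from \<open>e i\<close> onto
      \<open>w k\<close>, producing \<open>u k\<close>.\<close>
    have xi: "x $ i = (\<Sum>k\<in>UNIV. (cmod (cinner (u k) (e i)))\<^sup>2)" for i
    proof -
      have "complex_of_real (x $ i) = complex_of_real (\<Sum>k\<in>UNIV. (cmod (cinner (u k) (e i)))\<^sup>2)"
        unfolding x trace_compression[OF assms(2)] rho unfolding u_def P ..
      then show ?thesis by (simp only: of_real_eq_iff)
    qed
    \<comment> \<open>Only nonzero vectors can be normalised; the others add nothing to the weights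
      or to \<open>x\<close>.\<close>
    define K where "K = {k. u k \<noteq> 0}"
    have "\<exists>y. \<forall>k\<in>K. y k \<in> moment e S \<and>
        (\<chi> i. (cmod (cinner (u k) (e i)))\<^sup>2) = (norm (u k))\<^sup>2 *\<^sub>R y k"
      using scaled_in_moment[OF assms(2) uS, of _ e] by (intro bchoice) (auto simp: K_def Bex_def)
    then obtain y where y: "\<And>k. k \<in> K \<Longrightarrow> y k \<in> moment e S"
      "\<And>k. k \<in> K \<Longrightarrow> (\<chi> i. (cmod (cinner (u k) (e i)))\<^sup>2) = (norm (u k))\<^sup>2 *\<^sub>R y k"
      by blast
    \<comment> \<open>The hyperplane condition enters here: by Parseval and an exchange of sums, the
      total weight is the sum of the coordinates of \<open>x\<close>.\<close>
    have "(\<Sum>k\<in>K. (norm (u k))\<^sup>2) = (\<Sum>k\<in>UNIV. (norm (u k))\<^sup>2)"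
      by (rule sum.mono_neutral_left) (auto simp: K_def)
    also have "\<dots> = (\<Sum>i\<in>UNIV. x $ i)"
      unfolding xi parseval[OF assms(1), symmetric] by (rule sum.swap)
    finally have "(\<Sum>k\<in>K. (norm (u k))\<^sup>2) = 1" using sum_x by simp
    then have "(\<Sum>k\<in>K. (norm (u k))\<^sup>2 *\<^sub>R y k) \<in> moment e S"
      by (intro convex_sum) (use y(1) in \<open>auto simp: moment_def\<close>)
    moreover have "x = (\<Sum>k\<in>UNIV. \<chi> i. (cmod (cinner (u k) (e i)))\<^sup>2)"
      by (simp add: vec_eq_iff xi)
    moreover have "\<dots> = (\<Sum>k\<in>K. \<chi> i. (cmod (cinner (u k) (e i)))\<^sup>2)"
      by (rule sum.mono_neutral_right) (auto simp: K_def vec_eq_iff cinner_def)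
    ultimately show "x \<in> moment e S" by (simp add: y(2))
  qed
qed

end
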